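(* For the crossed graph $G=G_\times$, $$\mathcal R_G^{\mathrm{reg}}\not\subseteq\mathcal M_G^{\mathrm{bc}},$$ i.e. there is a regular scalar secular state on $G_\times$ whose edge-energy vector does not belong to the boundary-aware singular-completion cone.
   Context: **Graph.** $G_\times$ has internal vertices $v_1,v_2,v_3,v_4$ with standard Kirchhoff conditions and two exterior degree-one Dirichlet vertices $b_2,b_4$. Its seven edges are $e_{12}=v_1v_2$, $e_{23}=v_2v_3$, $e_{34}=v_3v_4$, $e_{13}=v_1v_3$, $e_{14}=v_1v_4$, $e_{\mathrm{ext},2}=v_2b_2$, $e_{\mathrm{ext},4}=v_4b_4$. Orient the edges. **Regular edge energies.** A regular scalar secular state at $\theta\in(\mathbb R/2\pi\mathbb Z)^7$ consists of real vertex values $\phi_v$ ($v=v_1,\dots,v_4$) and real normalized outward derivatives $p_{v,e}$ (for each incidence of an edge with an internal vertex), not all zero, with $\sum_{e\sim v}p_{v,e}=0$ at each $v_i$; for each internal--internal edge $e=vw$, $\theta_e\notin\pi\mathbb Z$, $\phi_w=\phi_v\cos\theta_e+p_{v,e}\sin\theta_e$, $-p_{w,e}=-\phi_v\sin\theta_e+p_{v,e}\cos\theta_e$; for each Dirichlet terminal edge at $v$, $\phi_v\cos\theta_e+p_{v,e}\sin\theta_e=0$. Its edge-energy vector is $r_e=\phi_v^2+p_{v,e}^2$. $\mathcal R_G^{\mathrm{reg}}$ is the set of all such vectors $r\in[0,\infty)^7$. **Singular cone.** A boundary-compatible singular sector $\sigma$ assigns a parity $\sigma_e\in\{\pm1\}$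 ($\sigma_e=\cos\theta_e$, $\theta_e\in\pi\mathbb Z$) to each of the five internal--internal edges and a phase class in $\pi\mathbb Z$ to each Dirichlet terminal edge. The matrix $B_{\sigma,\mathrm{bc}}$ (rows $v_1,\dots,v_4$, columns the edges) has entries $1$ at $v_-$ and $-\sigma_e$ at $v_+$ for an internal--internal edge oriented from $v_-$ to $v_+$, a single entry $1$ at the internal endpoint of a terminal edge, and zeros elsewhere. With $A^{\circ2}=(A_e^2)_e$, $\mathcal M_G^{\mathrm{bc}}$ is the convex cone generated by $\bigcup_\sigma\{A^{\circ2}:A\in\ker B_{\sigma,\mathrm{bc}}\}$. *)

theory Defs
  imports "HOL-Analysis.Analysis"
begin

section \<open>The crossed graph\<close>

datatype ivertex = V1 | V2 | V3 | V4

datatype vertex = Internal ivertex | B2 | B4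

datatype edge = E12 | E23 | E34 | E13 | E14 | Ext2 | Ext4

lemma UNIV_ivertex: "(UNIV :: ivertex set) = {V1, V2, V3, V4}"
  by (auto intro: ivertex.exhaust)

lemma UNIV_edge: "(UNIV :: edge set) = {E12, E23, E34, E13, E14, Ext2, Ext4}"
  by (auto intro: edge.exhaust)

instance ivertex :: finite
  by standard (simp add: UNIV_ivertex)

instance edge :: finite
  by standard (simp add: UNIV_edge)

fun ends :: "edge \<Rightarrow> vertex set" where
  "ends E12 = {Internal V1, Internal V2}"
| "ends E23 = {Internal V2, Internal V3}"
| "ends E34 = {Internal V3, Internal V4}"
| "ends E13 = {Internal V1, Internal V3}"
| "ends E14 = {Internal V1, Internal V4}"
| "ends Ext2 = {Internal V2, B2}"
| "ends Ext4 = {Internal V4, B4}"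

definition incident :: "ivertex \<Rightarrow> edge \<Rightarrow> bool" where
  "incident v e \<longleftrightarrow> Internal v \<in> ends e"

definition internal_edge :: "edge \<Rightarrow> bool" where
  "internal_edge e \<longleftrightarrow> ends e \<subseteq> range Internal"

definition terminal_edge :: "edge \<Rightarrow> bool" where
  "terminal_edge e \<longleftrightarrow> \<not> internal_edge e"

text \<open>An orientation chooses for each edge its initial vertex (\<open>src\<close>, written $v_-$) and its
  final vertex (\<open>tgt\<close>, written $v_+$).\<close>

definition orientation :: "(edge \<Rightarrow> vertex) \<Rightarrow> (edge \<Rightarrow> vertex) \<Rightarrow> bool" where
  "orientation src tgt \<longleftrightarrow> (\<forall>e. ends e = {src e, tgt e})"

lemma ex_orientation: "\<exists>src tgt. orientation src tgt"
proof -
  have "\<exists>a b. ends e = {a, b}" for e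
    by (cases e) auto
  then show ?thesis
    unfolding orientation_def by metis
qed

section \<open>Regular edge energies\<close>

definition pi_int :: "real set" where
  "pi_int = {of_int k * pi | k :: int. True}"

text \<open>A point of the torus $(\mathbb R/2\pi\mathbb Z)^7$ is given by a real representative
  \<open>\<theta>\<close>; all conditions on \<open>\<theta>\<close> are \<open>2\<pi>\<close>-periodic in each coordinate.

  The values \<open>p v e\<close> matter only for incident \<open>v\<close>, \<open>e\<close>; no condition refers to the others.
  The transfer relations of an internal edge are required from both ends; since
  $(\phi_v, p_{v,e}) \mapsto (\phi_w, p_{w,e})$ is an involution, this is the same as requiring
  them from one end only.\<close>

definition regular_state ::
  "(edge \<Rightarrow> real) \<Rightarrow> (ivertex \<Rightarrow> real) \<Rightarrow> (ivertex \<Rightarrow> edge \<Rightarrow> real) \<Rightarrow> bool" where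
  "regular_state \<theta> \<phi> p \<longleftrightarrow>
     ((\<exists>v. \<phi> v \<noteq> 0) \<or> (\<exists>v e. incident v e \<and> p v e \<noteq> 0)) \<and>
     (\<forall>v. (\<Sum>e | incident v e. p v e) = 0) \<and>
     (\<forall>e. internal_edge e \<longrightarrow> \<theta> e \<notin> pi_int) \<and>
     (\<forall>e v w. ends e = {Internal v, Internal w} \<longrightarrow>
        \<phi> w = \<phi> v * cos (\<theta> e) + p v e * sin (\<theta> e) \<and>
        - p w e = - \<phi> v * sin (\<theta> e) + p v e * cos (\<theta> e)) \<and>
     (\<forall>e v. terminal_edge e \<and> incident v e \<longrightarrow>
        \<phi> v * cos (\<theta> e) + p v e * sin (\<theta> e) = 0)"

text \<open>On an internal edge the energy is the same at both ends for every regular state, since the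
  transfer relation preserves the Euclidean norm.\<close>

definition edge_energy ::
  "(ivertex \<Rightarrow> real) \<Rightarrow> (ivertex \<Rightarrow> edge \<Rightarrow> real) \<Rightarrow> real ^ edge \<Rightarrow> bool" where
  "edge_energy \<phi> p r \<longleftrightarrow> (\<forall>v e. incident v e \<longrightarrow> r $ e = (\<phi> v)\<^sup>2 + (p v e)\<^sup>2)"

definition R_reg :: "(real ^ edge) set" where
  "R_reg = {r. \<exists>\<theta> \<phi> p. regular_state \<theta> \<phi> p \<and> edge_energy \<phi> p r}"

section \<open>The boundary-aware singular-completion cone\<close>

text \<open>A sector consists of the parities \<open>\<sigma>\<close> of the internal edges and the phases \<open>\<tau>\<close> of the
  terminal edges, the latter again given by real representatives. The values of \<open>\<sigma>\<close> on
  terminal edges and of \<open>\<tau>\<close> on internal edges play no role.\<close>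

definition bc_sector :: "(edge \<Rightarrow> real) \<Rightarrow> (edge \<Rightarrow> real) \<Rightarrow> bool" where
  "bc_sector \<sigma> \<tau> \<longleftrightarrow>
     (\<forall>e. internal_edge e \<longrightarrow> \<sigma> e \<in> {1, -1}) \<and>
     (\<forall>e. terminal_edge e \<longrightarrow> \<tau> e \<in> pi_int)"

definition B_bc ::
  "(edge \<Rightarrow> vertex) \<Rightarrow> (edge \<Rightarrow> vertex) \<Rightarrow> (edge \<Rightarrow> real) \<Rightarrow> real ^ edge ^ ivertex" where
  "B_bc src tgt \<sigma> = (\<chi> v e.
     if internal_edge e then
       (if Internal v = src e then 1 else if Internal v = tgt e then - \<sigma> e else 0)
     else (if incident v e then 1 else 0))"

definition hadamard_square :: "real ^ edge \<Rightarrow> real ^ edge" where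
  "hadamard_square A = (\<chi> e. (A $ e)\<^sup>2)"

definition M_bc :: "(edge \<Rightarrow> vertex) \<Rightarrow> (edge \<Rightarrow> vertex) \<Rightarrow> (real ^ edge) set" where
  "M_bc src tgt = convex_cone hull
     (\<Union>(\<sigma>, \<tau>) \<in> {(\<sigma>, \<tau>). bc_sector \<sigma> \<tau>}. hadamard_square ` {A. B_bc src tgt \<sigma> *v A = 0})"

end

theory Submission
  imports Defs
begin

text \<open>A linear functional separates one regular energy vector from the singular cone.

  On the face $r_{\mathrm{ext},2} = 0$, every singular amplitude vector has $|A_{12}| = |A_{23}|$;
  call this number $x$ and put $y = |A_{13}|$. By the relations at $V_1$ and $V_3$, each of $|A_{14}|$
  and $|A_{34}|$ is either $x + y$ or $|x - y|$. The generators of the cone on this face satisfy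
  \[ 2 (A_{34}^2 - A_{13}^2 - A_{23}^2) \le A_{14}^2 + 2 A_{\mathrm{ext},4}^2 . \]
  The left side is at most $0$ if $|A_{34}| = |x - y|$, and it is $4 x y$ if $|A_{34}| = x + y$. In
  the latter case, if $|A_{14}| = x + y$, the inequality follows from $4 x y \le (x + y)^2$. If
  $|A_{14}| = |x - y|$, the relation at $V_4$ forces $|A_{\mathrm{ext},4}| \ge 2 \min(x, y)$, and the
  inequality follows from $(\max(x, y) - 3 \min(x, y))^2 \ge 0$. Being linear in the energies, the
  inequality holds for all points of the cone with $r_{\mathrm{ext},2} = 0$.

  A regular state can violate it. A large value at $V_1$ allows $r_{14}$ to lie between the
  extremes $(x - y)^2$ and $(x + y)^2$, as for a mixture of singular amplitudes. In such a mixture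
  the components with $|A_{14}| = |x - y|$ contribute a large terminal energy at $V_4$. In the regular
  state the value $0$ at $V_4$ allows the derivatives on \<open>E34\<close> and \<open>E14\<close> to cancel there as
  in a single singular vector, with
  $\sqrt{r_{\mathrm{ext},4}} = \sqrt{r_{34}} - \sqrt{r_{14}}$. The state \<open>wit_value\<close>, \<open>wit_deriv\<close> has $r_{12} = r_{23} = r_{13} = 13$,
  $r_{34} = 49$, $r_{14} = 16$, $r_{\mathrm{ext},2} = 0$ and $r_{\mathrm{ext},4} = 9$, and the two
  sides become $46$ and $34$.

  To avoid arguing about faces, the inequality is extended to the whole cone by adding multiples of
  $r_{12}$ and $r_{\mathrm{ext},2}$; this is the functional \<open>sep\<close>. It is nonnegative on
  the singular generators because it becomes a sum of squares on the kernel of each sector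
  (\<open>sep_form_nonneg\<close>, \<open>sep_nonneg_of_signed_kirchhoff\<close>), while its value at the regular vector
  is $2 (34 - 46) + 13 = -11$.\<close>

section \<open>A functional that is nonnegative on the singular cone\<close>

text \<open>Twice the inequality on the face $r_{\mathrm{ext},2} = 0$, plus
  $r_{12} + 20\, r_{\mathrm{ext},2}$. The weight of \<open>Ext2\<close> costs nothing at a regular vector on the
  face. Without the term $r_{12}$ no finite weight of \<open>Ext2\<close> would do, because the inequality on
  the face is sharp; with it, $20$ is the least weight that works.\<close>

definition sep :: "real ^ edge" where
  "sep = (\<chi> e. case e of E12 \<Rightarrow> 1 | E23 \<Rightarrow> 4 | E34 \<Rightarrow> -4 | E13 \<Rightarrow> 4 | E14 \<Rightarrow> 2
                     | Ext2 \<Rightarrow> 20 | Ext4 \<Rightarrow> 4)"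

lemma sep_inner:
  "sep \<bullet> r = r $ E12 + 4 * r $ E23 - 4 * r $ E34 + 4 * r $ E13 + 2 * r $ E14
             + 20 * r $ Ext2 + 4 * r $ Ext4"
  by (simp add: inner_vec_def sep_def UNIV_edge)

text \<open>The kernel of a sector is three-dimensional, with coordinates \<open>a\<close>, \<open>b\<close>, \<open>c\<close> on \<open>E12\<close>, \<open>E14\<close>,
  \<open>E23\<close>; up to signs of amplitudes it depends only on the parities \<open>s\<close> and \<open>t\<close> of the two
  triangles. The inequality says that the four resulting quadratic forms are positive
  semidefinite.\<close>

lemma sep_form_nonneg:
  fixes a b c s t :: real
  assumes s: "s \<in> {1, -1}" and t: "t \<in> {1, -1}"
  shows "0 \<le> a\<^sup>2 + 4 * c\<^sup>2 - 4 * (a + b - c)\<^sup>2 + 4 * (a + b)\<^sup>2 + 2 * b\<^sup>2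
              + 20 * (s * a + c)\<^sup>2 + 4 * (t * b + (a + b - c))\<^sup>2" (is "0 \<le> ?Q")
proof -
  have ss: "s * s = 1"
    using s by auto
  from t consider "t = 1" | "t = -1" by blast
  then show ?thesis
  proof cases
    case 1
    have Q: "?Q = 25 * (s * s) * a\<^sup>2 + 16 * (s * s) * (a * b) + 40 * s * (a * c) + 18 * b\<^sup>2
                  + 24 * c\<^sup>2 - 8 * (b * c)"
      using ss 1 by (simp add: power2_eq_square) algebra
    from s consider "s = 1" | "s = -1" by blast
    then show ?thesis
    proof cases
      case 1
      have "?Q = (5 * a + 4 * c + 8 / 5 * b)\<^sup>2 + 8 * (c - 13 / 10 * b)\<^sup>2 + 48 / 25 * b\<^sup>2"
        unfolding Q by (simp add: 1 power2_eq_square algebra_simps)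
      then show ?thesis by simp
    next
      case 2
      have "?Q = (5 * a - 4 * c + 8 / 5 * b)\<^sup>2 + 8 * (c + 3 / 10 * b)\<^sup>2 + 368 / 25 * b\<^sup>2"
        unfolding Q by (simp add: 2 power2_eq_square algebra_simps)
      then show ?thesis by simp
    qed
  next
    case 2
    have "?Q = 2 * (b + 2 * c)\<^sup>2 + (5 * a + 4 * s * c)\<^sup>2"
      using ss 2 by (simp add: power2_eq_square) algebra
    then show ?thesis by simp
  qed
qed

text \<open>Orientation and parities enter only through the two signs that each internal edge carries at
  its ends. Changing the signs of amplitudes leaves the energies unchanged, and rescaling
  the Kirchhoff equations by signs leaves only the two triangle parities.\<close>

lemma sep_nonneg_of_signed_kirchhoff:
  fixes A :: "real ^ edge" and k :: "ivertex \<Rightarrow> edge \<Rightarrow> real"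
  assumes k: "\<And>v e. k v e \<in> {1, -1}"
    and v1: "k V1 E12 * A $ E12 + k V1 E13 * A $ E13 + k V1 E14 * A $ E14 = 0"
    and v2: "k V2 E12 * A $ E12 + k V2 E23 * A $ E23 + A $ Ext2 = 0"
    and v3: "k V3 E23 * A $ E23 + k V3 E34 * A $ E34 + k V3 E13 * A $ E13 = 0"
    and v4: "k V4 E34 * A $ E34 + k V4 E14 * A $ E14 + A $ Ext4 = 0"
  shows "0 \<le> sep \<bullet> hadamard_square A"
proof -
  have sq: "k v e * k v e = 1" for v e
    using k[of v e] by auto
  have mult: "x * y \<in> {1, -1}" if "x \<in> {1, -1}" "y \<in> {1, -1}" for x y :: real
    using that by auto
  have square: "(x * y)\<^sup>2 = y\<^sup>2" if "x \<in> {1, -1}" for x y :: real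
    using that by auto
  \<comment> \<open>\<open>m\<close> rescales the equation at \<open>V3\<close> so that \<open>E13\<close> has the same coefficient there and at \<open>V1\<close>.\<close>
  define m where "m = k V1 E13 * k V3 E13"
  define s where "s = m * k V3 E23 * k V2 E23 * k V2 E12 * k V1 E12"
  define t where "t = m * k V3 E34 * k V4 E34 * k V4 E14 * k V1 E14"
  define a where "a = k V1 E12 * A $ E12"
  define b where "b = k V1 E14 * A $ E14"
  define c where "c = m * k V3 E23 * A $ E23"
  have m: "m \<in> {1, -1}"
    unfolding m_def by (intro mult k)
  have s: "s \<in> {1, -1}" and t: "t \<in> {1, -1}"
    unfolding s_def t_def by (intro mult k m)+
  have e13: "k V1 E13 * A $ E13 = - (a + b)"
    using v1 unfolding a_def b_def by simp
  have "m * (k V3 E23 * A $ E23 + k V3 E34 * A $ E34 + k V3 E13 * A $ E13) = 0"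
    using v3 by simp
  then have "c + m * k V3 E34 * A $ E34 + (k V3 E13 * k V3 E13) * (k V1 E13 * A $ E13) = 0"
    by (simp add: c_def m_def algebra_simps)
  then have e34: "m * k V3 E34 * A $ E34 = a + b - c"
    by (simp add: sq e13)
  have "(m * k V3 E23 * k V2 E23) * (k V2 E12 * A $ E12 + k V2 E23 * A $ E23 + A $ Ext2) = 0"
    using v2 by simp
  then have "s * a + c + m * k V3 E23 * k V2 E23 * A $ Ext2
      = (m * k V3 E23 * k V2 E23 * k V2 E12 * A $ E12) * (k V1 E12 * k V1 E12 - 1)
        + (m * k V3 E23 * A $ E23) * (1 - k V2 E23 * k V2 E23)"
    by (simp add: s_def a_def c_def algebra_simps)
  then have ext2: "m * k V3 E23 * k V2 E23 * A $ Ext2 = - (s * a + c)"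
    unfolding sq by simp
  have "(m * k V3 E34 * k V4 E34) * (k V4 E34 * A $ E34 + k V4 E14 * A $ E14 + A $ Ext4) = 0"
    using v4 by simp
  then have "(m * k V3 E34 * A $ E34) * (k V4 E34 * k V4 E34) + t * b
        + m * k V3 E34 * k V4 E34 * A $ Ext4
      = (m * k V3 E34 * k V4 E34 * k V4 E14 * A $ E14) * (k V1 E14 * k V1 E14 - 1)"
    by (simp add: t_def b_def algebra_simps)
  then have ext4: "m * k V3 E34 * k V4 E34 * A $ Ext4 = - (t * b + (a + b - c))"
    unfolding sq e34 by simp
  have "(A $ E12)\<^sup>2 = a\<^sup>2" "(A $ E14)\<^sup>2 = b\<^sup>2" "(A $ E23)\<^sup>2 = c\<^sup>2"
    unfolding a_def b_def c_def by (intro square[symmetric] mult k m)+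
  moreover have "(A $ E13)\<^sup>2 = (a + b)\<^sup>2"
    using square[of "k V1 E13" "A $ E13"] k unfolding e13 power2_minus by simp
  moreover have "(A $ E34)\<^sup>2 = (a + b - c)\<^sup>2"
    unfolding e34[symmetric] by (intro square[symmetric] mult k m)
  moreover have "(A $ Ext2)\<^sup>2 = (s * a + c)\<^sup>2"
    unfolding power2_minus[of "s * a + c", symmetric] ext2[symmetric]
    by (intro square[symmetric] mult k m)
  moreover have "(A $ Ext4)\<^sup>2 = (t * b + (a + b - c))\<^sup>2"
    unfolding power2_minus[of "t * b + (a + b - c)", symmetric] ext4[symmetric]
    by (intro square[symmetric] mult k m)
  ultimately show ?thesis
    using sep_form_nonneg[OF s t, of a c b]
    unfolding sep_inner hadamard_square_def by simp
qed

lemma internal_edge_simps: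
  "internal_edge E12" "internal_edge E23" "internal_edge E34" "internal_edge E13"
  "internal_edge E14" "\<not> internal_edge Ext2" "\<not> internal_edge Ext4"
  by (auto simp: internal_edge_def)

lemma B_bc_not_incident:
  assumes "orientation src tgt" "\<not> incident v e"
  shows "B_bc src tgt \<sigma> $ v $ e = 0"
proof -
  have "ends e = {src e, tgt e}"
    using assms(1) by (simp add: orientation_def)
  then show ?thesis
    using assms(2) by (auto simp: B_bc_def incident_def)
qed

lemma B_bc_internal_sign:
  assumes "orientation src tgt" "bc_sector \<sigma> \<tau>" "internal_edge e" "incident v e"
  shows "B_bc src tgt \<sigma> $ v $ e \<in> {1, -1}"
proof -
  have "ends e = {src e, tgt e}"
    using assms(1) by (simp add: orientation_def)
  moreover have "\<sigma> e \<in> {1, -1}"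
    using assms(2,3) by (simp add: bc_sector_def)
  ultimately show ?thesis
    using assms(3,4) by (auto simp: B_bc_def incident_def)
qed

lemma sep_nonneg_on_kernel:
  assumes ori: "orientation src tgt" and sec: "bc_sector \<sigma> \<tau>"
    and ker: "B_bc src tgt \<sigma> *v A = 0"
  shows "0 \<le> sep \<bullet> hadamard_square A"
proof -
  let ?B = "B_bc src tgt \<sigma>"
  \<comment> \<open>Off the internal incidences the value of \<open>k\<close> is arbitrary.\<close>
  define k where "k v e = (if internal_edge e \<and> incident v e then ?B $ v $ e else 1)" for v e
  have k: "k v e \<in> {1, -1}" for v e
    using B_bc_internal_sign[OF ori sec] by (simp add: k_def)
  have B: "?B $ v $ e = (if incident v e then k v e else 0)" for v e
    by (auto simp: k_def B_bc_not_incident[OF ori]) (simp add: B_bc_def)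
  have row: "(\<Sum>e\<in>UNIV. (if incident v e then k v e else 0) * A $ e) = 0" for v
    using arg_cong[OF ker, of "\<lambda>x. x $ v"] by (simp add: matrix_vector_mult_def B)
  have ext: "k v Ext2 = 1" "k v Ext4 = 1" for v
    by (simp_all add: k_def internal_edge_simps)
  show ?thesis
    by (rule sep_nonneg_of_signed_kirchhoff[of k])
      (use k row[of V1] row[of V2] row[of V3] row[of V4] in
        \<open>simp_all add: UNIV_edge incident_def ext algebra_simps\<close>)
qed

lemma sep_nonneg_on_M_bc:
  assumes "orientation src tgt" and "r \<in> M_bc src tgt"
  shows "0 \<le> sep \<bullet> r"
proof -
  have "M_bc src tgt \<subseteq> {r. 0 \<le> sep \<bullet> r}"
    unfolding M_bc_def
  proof (rule hull_minimal)
    show "convex_cone {r. 0 \<le> sep \<bullet> r}"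
      using convex_cone_halfspace_ge[of sep] by simp
  qed (auto intro: sep_nonneg_on_kernel[OF assms(1)])
  then show ?thesis
    using assms(2) by auto
qed

section \<open>A regular state with negative value\<close>

text \<open>Regular states are easy to produce because phases need not be chosen beforehand: data of equal
  energy at the two ends, $(a, b)$ and $(c, d)$, are always related by a phase. The transfer relation
  says $c - i d = e^{-i t} (a + i b)$, so $e^{i t}$ is $(a + i b)(c + i d)$ divided by the energy, and
  $\sin t$ is proportional to $a d + b c$.\<close>

lemma ex_transfer_phase:
  fixes a b c d :: real
  assumes eq: "a\<^sup>2 + b\<^sup>2 = c\<^sup>2 + d\<^sup>2" and reg: "a * d + b * c \<noteq> 0"
  shows "\<exists>t. t \<notin> pi_int \<and> c = a * cos t + b * sin t \<and> - d = - a * sin t + b * cos t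
           \<and> a = c * cos t + d * sin t \<and> - b = - c * sin t + d * cos t"
proof -
  define n where "n = a\<^sup>2 + b\<^sup>2"
  have n: "n \<noteq> 0"
    using reg by (auto simp: n_def sum_power2_eq_zero_iff)
  have n': "n = c\<^sup>2 + d\<^sup>2"
    using eq by (simp add: n_def)
  define C where "C = (a * c - b * d) / n"
  define S where "S = (a * d + b * c) / n"
  have nC: "n * C = a * c - b * d" and nS: "n * S = a * d + b * c"
    using n by (simp_all add: C_def S_def)
  have "n\<^sup>2 * (C\<^sup>2 + S\<^sup>2) = (n * C)\<^sup>2 + (n * S)\<^sup>2"
    by (simp add: algebra_simps power2_eq_square)
  also have "\<dots> = (a\<^sup>2 + b\<^sup>2) * (c\<^sup>2 + d\<^sup>2)"
    unfolding nC nS by (simp add: algebra_simps power2_eq_square)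
  also have "\<dots> = n\<^sup>2 * 1"
    using eq by (simp add: n_def power2_eq_square)
  finally have "C\<^sup>2 + S\<^sup>2 = 1"
    using n by simp
  then obtain t where t: "C = cos t" "S = sin t"
    using sincos_total_2pi by metis
  have cancel: "x = y" if "n * x = n * y" for x y :: real
    using that n by simp
  have "n * c = n * (a * C + b * S)" "n * (- d) = n * (- a * S + b * C)"
    using nC nS n_def by algebra+
  moreover have "n * a = n * (c * C + d * S)" "n * (- b) = n * (- c * S + d * C)"
    using nC nS n' by algebra+
  moreover have "t \<notin> pi_int"
  proof -
    have "sin t \<noteq> 0"
      using reg nS t by auto
    then show ?thesis
      unfolding pi_int_def sin_zero_iff_int2 by auto
  qed
  ultimately show ?thesis
    using cancel t by metis
qed

text \<open>The values vanish at \<open>V2\<close> and \<open>V4\<close>, so that the derivatives at these vertices cancel as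
  amplitudes of a singular state do. A nonzero value at \<open>V3\<close>, small compared with that at \<open>V1\<close>, keeps the phases of \<open>E23\<close> and \<open>E34\<close> away from
  multiples of $\pi$; the value $1$ and the value $\sqrt{12}$ at \<open>V1\<close> make all energies integers.\<close>

fun wit_value :: "ivertex \<Rightarrow> real" where
  "wit_value V1 = sqrt 12"
| "wit_value V2 = 0"
| "wit_value V3 = 1"
| "wit_value V4 = 0"

fun wit_deriv :: "ivertex \<Rightarrow> edge \<Rightarrow> real" where
  "wit_deriv V1 E12 = 1"
| "wit_deriv V1 E13 = 1"
| "wit_deriv V1 E14 = -2"
| "wit_deriv V2 E12 = sqrt 13"
| "wit_deriv V2 E23 = - sqrt 13"
| "wit_deriv V3 E13 = sqrt 12"
| "wit_deriv V3 E23 = sqrt 12"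
| "wit_deriv V3 E34 = -2 * sqrt 12"
| "wit_deriv V4 E34 = 7"
| "wit_deriv V4 E14 = -4"
| "wit_deriv V4 Ext4 = -3"
| "wit_deriv _ _ = 0"

definition wit_energy :: "real ^ edge" where
  "wit_energy = (\<chi> e. case e of E12 \<Rightarrow> 13 | E23 \<Rightarrow> 13 | E34 \<Rightarrow> 49 | E13 \<Rightarrow> 13 | E14 \<Rightarrow> 16
                            | Ext2 \<Rightarrow> 0 | Ext4 \<Rightarrow> 9)"

lemma incident_edges:
  "{e. incident V1 e} = {E12, E13, E14}"
  "{e. incident V2 e} = {E12, E23, Ext2}"
  "{e. incident V3 e} = {E23, E34, E13}"
  "{e. incident V4 e} = {E34, E14, Ext4}"
proof -
  have "(e \<in> {e. incident V1 e}) = (e \<in> {E12, E13, E14})"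
    "(e \<in> {e. incident V2 e}) = (e \<in> {E12, E23, Ext2})"
    "(e \<in> {e. incident V3 e}) = (e \<in> {E23, E34, E13})"
    "(e \<in> {e. incident V4 e}) = (e \<in> {E34, E14, Ext4})" for e
    by (cases e; simp add: incident_def)+
  then show "{e. incident V1 e} = {E12, E13, E14}"
    "{e. incident V2 e} = {E12, E23, Ext2}"
    "{e. incident V3 e} = {E23, E34, E13}"
    "{e. incident V4 e} = {E34, E14, Ext4}"
    by blast+
qed

lemma wit_edge_energy: "edge_energy wit_value wit_deriv wit_energy"
proof -
  have "wit_energy $ e = (wit_value v)\<^sup>2 + (wit_deriv v e)\<^sup>2" if "incident v e" for v e
    using that by (cases v; cases e) (auto simp: incident_def wit_energy_def power_mult_distrib)
  then show ?thesis
    by (simp add: edge_energy_def)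
qed

lemma wit_regular: "\<exists>\<theta>. regular_state \<theta> wit_value wit_deriv"
proof -
  define P where "P e t \<longleftrightarrow>
     (internal_edge e \<longrightarrow> t \<notin> pi_int) \<and>
     (\<forall>v w. ends e = {Internal v, Internal w} \<longrightarrow>
        wit_value w = wit_value v * cos t + wit_deriv v e * sin t \<and>
        - wit_deriv w e = - wit_value v * sin t + wit_deriv v e * cos t) \<and>
     (\<forall>v. terminal_edge e \<and> incident v e \<longrightarrow>
        wit_value v * cos t + wit_deriv v e * sin t = 0)" for e t
  have "\<exists>t. P e t" for e
  proof -
    have internal: "\<exists>t. P e t"
      if ends: "ends e = {Internal v, Internal w}"
        and reg: "wit_value v * wit_deriv w e + wit_deriv v e * wit_value w \<noteq> 0" for v w
    proof -
      have "incident v e" "incident w e" "internal_edge e"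
        using ends by (auto simp: incident_def internal_edge_def)
      then have "(wit_value v)\<^sup>2 + (wit_deriv v e)\<^sup>2 = (wit_value w)\<^sup>2 + (wit_deriv w e)\<^sup>2"
        using wit_edge_energy unfolding edge_energy_def by metis
      from ex_transfer_phase[OF this reg] obtain t where t: "t \<notin> pi_int"
        "wit_value w = wit_value v * cos t + wit_deriv v e * sin t \<and>
         - wit_deriv w e = - wit_value v * sin t + wit_deriv v e * cos t"
        "wit_value v = wit_value w * cos t + wit_deriv w e * sin t \<and>
         - wit_deriv v e = - wit_value w * sin t + wit_deriv w e * cos t"
        by blast
      have "(v', w') = (v, w) \<or> (v', w') = (w, v)" if "ends e = {Internal v', Internal w'}" for v' w'
        using that unfolding ends by (auto simp: doubleton_eq_iff)
      then have "P e t"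
        using t \<open>internal_edge e\<close> unfolding P_def terminal_edge_def by blast
      then show ?thesis ..
    qed
    \<comment> \<open>At the terminal edges the value vanishes, so the phase $0$ satisfies the Dirichlet condition.\<close>
    have terminal: "\<exists>t. P e t" if "e = Ext2 \<or> e = Ext4"
    proof
      have "ends e \<noteq> {Internal v, Internal w}" for v w
        using that by (elim disjE) (simp_all add: doubleton_eq_iff)
      moreover have "wit_value v = 0" if "incident v e" for v
        using that \<open>e = Ext2 \<or> e = Ext4\<close> by (cases v) (auto simp: incident_def)
      moreover have "\<not> internal_edge e"
        using that internal_edge_simps by blast
      ultimately show "P e 0"
        unfolding P_def by simp
    qed
    show ?thesis
    proof (cases e)
      case E12 then show ?thesis by (intro internal[of V1 V2]) auto
    next
      case E23 then show ?thesis by (intro internal[of V2 V3]) auto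
    next
      case E34 then show ?thesis by (intro internal[of V3 V4]) auto
    next
      case E13 then show ?thesis by (intro internal[of V1 V3]) auto
    next
      case E14 then show ?thesis by (intro internal[of V1 V4]) auto
    qed (use terminal in auto)
  qed
  then obtain \<theta> where \<theta>: "\<And>e. P e (\<theta> e)"
    by metis
  have "wit_value V3 \<noteq> 0"
    by simp
  moreover have "(\<Sum>e | incident v e. wit_deriv v e) = 0" for v
    by (cases v) (simp_all add: incident_edges)
  ultimately have "regular_state \<theta> wit_value wit_deriv"
    using \<theta> unfolding P_def regular_state_def by blast
  then show ?thesis by blast
qed

lemma sep_wit_energy: "sep \<bullet> wit_energy = -11"
  by (simp add: sep_inner wit_energy_def)

theorem corollary7p13:
  fixes src tgt :: "edge \<Rightarrow> vertex"
  assumes "orientation src tgt"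
  shows "\<not> R_reg \<subseteq> M_bc src tgt"
proof
  assume "R_reg \<subseteq> M_bc src tgt"
  moreover have "wit_energy \<in> R_reg"
    using wit_regular wit_edge_energy unfolding R_reg_def by blast
  ultimately have "0 \<le> sep \<bullet> wit_energy"
    using sep_nonneg_on_M_bc[OF assms] by blast
  then show False
    by (simp add: sep_wit_energy)
qed

end
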